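(* Let $R$ be a commutative ring (with identity element) containing the rationals as a subring. Let $G(z,w)$ be a formal power series in indeterminates $z$ and $w=(w_i)_{i\in I}$, with coefficients in $R$, satisfying $G(0,0)=0$ and $(\partial G/\partial z)(0,0)=0$. Then there exists a unique formal power series $\varphi(w)$ (with coefficients in $R$) with zero constant term satisfying $\varphi(w)=G(\varphi(w),w)$, and its coefficients are given by the finite sums $$[w^\alpha]\varphi(w)=\sum_{m=1}^{2|\alpha|-1}\frac1m\,[\zeta^{m-1}w^\alpha]\,G(\zeta,w)^m.$$ More generally, if $H(z,w)$ is any formal power series (in the same indeterminates, with coefficients in $R$), we have $$[w^\alpha]H(\varphi(w),w)=[w^\alpha]H(0,w)+\sum_{m=1}^{2|\alpha|-1}\frac1m\,[\zeta^{m-1}w^\alpha]\,\frac{\partial H(\zeta,w)}{\partial\zeta}\,G(\zeta,w)^m.$$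
   Context: $I$ is an arbitrary finite or infinite index set. Here $\alpha=(\alpha_i)_{i\in I}$ ranges over multi-indices of nonnegative integers with finitely many nonzero entries, $w^\alpha=\prod_i w_i^{\alpha_i}$, and $|\alpha|=\sum_i\alpha_i$. $[w^\alpha]$ and $[\zeta^n w^\alpha]$ denote extraction of the coefficient of the indicated monomial from the whole formal power series written to the right. Subrings share the identity element. Empty sums are zero. *)

theory Defs
  imports
    "HOL-Library.Poly_Mapping"
    "HOL-Library.Groups_Big_Fun"
    "HOL-Computational_Algebra.Formal_Power_Series"
begin

section \<open>Multi-indices\<close>

text \<open>
  A multi-index is a finitely supported function of type \<^typ>\<open>'i \<Rightarrow>\<^sub>0 nat\<close>.
\<close>

definition midx_size :: "('i \<Rightarrow>\<^sub>0 nat) \<Rightarrow> nat" where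
  "midx_size \<alpha> = (\<Sum>i\<in>Poly_Mapping.keys \<alpha>. Poly_Mapping.lookup \<alpha> i)"

lemma midx_size_superset:
  assumes "finite A" "Poly_Mapping.keys \<alpha> \<subseteq> A"
  shows "midx_size \<alpha> = (\<Sum>i\<in>A. Poly_Mapping.lookup \<alpha> i)"
  unfolding midx_size_def
  by (rule sum.mono_neutral_left) (use assms in \<open>auto simp: in_keys_iff\<close>)

lemma midx_size_add: "midx_size (\<alpha> + \<beta>) = midx_size \<alpha> + midx_size \<beta>"
proof -
  let ?A = "Poly_Mapping.keys \<alpha> \<union> Poly_Mapping.keys \<beta>"
  have "Poly_Mapping.keys (\<alpha> + \<beta>) \<subseteq> ?A" by (rule Poly_Mapping.keys_add)
  then show ?thesis
    by (simp add: midx_size_superset[of ?A] lookup_add sum.distrib)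
qed

lemma midx_size_0 [simp]: "midx_size 0 = 0"
  by (simp add: midx_size_def)

lemma midx_size_eq_0_iff: "midx_size \<alpha> = 0 \<longleftrightarrow> \<alpha> = 0"
  by (auto simp: midx_size_def in_keys_iff intro!: poly_mapping_eqI)

definition splits :: "('i \<Rightarrow>\<^sub>0 nat) \<Rightarrow> (('i \<Rightarrow>\<^sub>0 nat) \<times> ('i \<Rightarrow>\<^sub>0 nat)) set" where
  "splits \<alpha> = {(\<beta>, \<gamma>). \<beta> + \<gamma> = \<alpha>}"

lemma finite_splits [simp]: "finite (splits \<alpha>)"
proof -
  let ?B = "{f. \<forall>x. (x \<in> Poly_Mapping.keys \<alpha> \<longrightarrow> f x \<in> {..midx_size \<alpha>}) \<and>
                (x \<notin> Poly_Mapping.keys \<alpha> \<longrightarrow> f x = (0::nat))}"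
  have "finite ?B" by (rule finite_set_of_finite_funs) auto
  moreover have "(\<lambda>(\<beta>, \<gamma>). (Poly_Mapping.lookup \<beta>, Poly_Mapping.lookup \<gamma>)) ` splits \<alpha> \<subseteq> ?B \<times> ?B"
  proof -
    have "Poly_Mapping.lookup \<alpha> x \<le> midx_size \<alpha>" for x
      unfolding midx_size_def
      by (cases "x \<in> Poly_Mapping.keys \<alpha>") (auto intro: member_le_sum simp: in_keys_iff)
    then have "Poly_Mapping.lookup \<beta> x + Poly_Mapping.lookup \<gamma> x \<le> midx_size \<alpha>"
      if "\<beta> + \<gamma> = \<alpha>" for \<beta> \<gamma> x
      using that by (metis lookup_add)
    then show ?thesis
      by (fastforce simp: splits_def in_keys_iff lookup_add dest: add_leD1 add_leD2)
  qed
  ultimately have "finite ((\<lambda>(\<beta>, \<gamma>). (Poly_Mapping.lookup \<beta>, Poly_Mapping.lookup \<gamma>)) ` splits \<alpha>)"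
    by (meson finite_SigmaI finite_subset)
  then show ?thesis
    by (rule finite_imageD) (auto simp: inj_on_def lookup_inject)
qed

lemma splits_0 [simp]: "splits 0 = {(0, 0)}"
proof -
  have "\<beta> = 0 \<and> \<gamma> = 0" if "\<beta> + \<gamma> = 0" for \<beta> \<gamma> :: "'i \<Rightarrow>\<^sub>0 nat"
    using that midx_size_add[of \<beta> \<gamma>] by (simp add: midx_size_eq_0_iff)
  then show ?thesis by (auto simp: splits_def)
qed

section \<open>Formal power series in a family of indeterminates\<close>

typedef ('i, 'r) mps = "UNIV :: (('i \<Rightarrow>\<^sub>0 nat) \<Rightarrow> 'r) set"
  morphisms mps_coeff Abs_mps ..

lemma mps_coeff_Abs [simp]: "mps_coeff (Abs_mps f) = f"
  by (simp add: Abs_mps_inverse)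

lemma mps_eqI: "(\<And>\<alpha>. mps_coeff f \<alpha> = mps_coeff g \<alpha>) \<Longrightarrow> f = g"
  by (metis ext mps_coeff_inject)

instantiation mps :: (type, comm_ring_1) comm_ring_1
begin

definition zero_mps :: "('a, 'b) mps" where "0 = Abs_mps (\<lambda>_. 0)"
definition one_mps :: "('a, 'b) mps" where "1 = Abs_mps (\<lambda>\<alpha>. if \<alpha> = 0 then 1 else 0)"
definition plus_mps :: "('a, 'b) mps \<Rightarrow> ('a, 'b) mps \<Rightarrow> ('a, 'b) mps" where
  "f + g = Abs_mps (\<lambda>\<alpha>. mps_coeff f \<alpha> + mps_coeff g \<alpha>)"
definition uminus_mps :: "('a, 'b) mps \<Rightarrow> ('a, 'b) mps" where
  "- f = Abs_mps (\<lambda>\<alpha>. - mps_coeff f \<alpha>)"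
definition minus_mps :: "('a, 'b) mps \<Rightarrow> ('a, 'b) mps \<Rightarrow> ('a, 'b) mps" where
  "f - g = Abs_mps (\<lambda>\<alpha>. mps_coeff f \<alpha> - mps_coeff g \<alpha>)"
definition times_mps :: "('a, 'b) mps \<Rightarrow> ('a, 'b) mps \<Rightarrow> ('a, 'b) mps" where
  "f * g = Abs_mps (\<lambda>\<alpha>. \<Sum>(\<beta>, \<gamma>)\<in>splits \<alpha>. mps_coeff f \<beta> * mps_coeff g \<gamma>)"

instance
proof
  fix f g h :: "('a, 'b) mps"
  show "f * g * h = f * (g * h)"
  proof (rule mps_eqI)
    fix \<alpha> :: "'a \<Rightarrow>\<^sub>0 nat"
    have "mps_coeff (f * g * h) \<alpha> =
        (\<Sum>x\<in>splits \<alpha>. \<Sum>y\<in>splits (fst x).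
          mps_coeff f (fst y) * mps_coeff g (snd y) * mps_coeff h (snd x))"
      by (simp add: times_mps_def case_prod_unfold sum_distrib_right)
    also have "\<dots> = (\<Sum>(x, y)\<in>Sigma (splits \<alpha>) (\<lambda>x. splits (fst x)).
          mps_coeff f (fst y) * mps_coeff g (snd y) * mps_coeff h (snd x))"
      by (rule sum.Sigma) auto
    also have "\<dots> = (\<Sum>(x, y)\<in>Sigma (splits \<alpha>) (\<lambda>x. splits (snd x)).
          mps_coeff f (fst x) * (mps_coeff g (fst y) * mps_coeff h (snd y)))"
      by (rule sum.reindex_bij_witness
          [of _ "\<lambda>((a, b), (c, d)). ((a + c, d), (a, c))" "\<lambda>((a, b), (c, d)). ((c, d + b), (d, b))"])
         (auto simp: splits_def add.assoc mult.assoc)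
    also have "\<dots> = (\<Sum>x\<in>splits \<alpha>. \<Sum>y\<in>splits (snd x).
          mps_coeff f (fst x) * (mps_coeff g (fst y) * mps_coeff h (snd y)))"
      by (rule sum.Sigma[symmetric]) auto
    also have "\<dots> = mps_coeff (f * (g * h)) \<alpha>"
      by (simp add: times_mps_def case_prod_unfold sum_distrib_left)
    finally show "mps_coeff (f * g * h) \<alpha> = mps_coeff (f * (g * h)) \<alpha>" .
  qed
  show "f * g = g * f"
  proof (rule mps_eqI)
    fix \<alpha> :: "'a \<Rightarrow>\<^sub>0 nat"
    show "mps_coeff (f * g) \<alpha> = mps_coeff (g * f) \<alpha>"
      unfolding times_mps_def mps_coeff_Abs
      by (rule sum.reindex_bij_witness[of _ prod.swap prod.swap])
         (auto simp: splits_def add.commute mult.commute)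
  qed
  show "1 * f = f"
  proof (rule mps_eqI)
    fix \<alpha> :: "'a \<Rightarrow>\<^sub>0 nat"
    have mem: "(0, \<alpha>) \<in> splits \<alpha>" unfolding splits_def by simp
    have "mps_coeff (1 * f) \<alpha> =
        (\<Sum>x\<in>splits \<alpha>. if x = (0, \<alpha>) then mps_coeff f \<alpha> else 0)"
      unfolding times_mps_def one_mps_def mps_coeff_Abs
      by (rule sum.cong) (auto simp: splits_def split: if_splits)
    also have "\<dots> = mps_coeff f \<alpha>"
      using mem by (simp only: sum.delta[OF finite_splits] if_True)
    finally show "mps_coeff (1 * f) \<alpha> = mps_coeff f \<alpha>" .
  qed
  show "(f + g) * h = f * h + g * h"
    by (rule mps_eqI)
       (simp add: times_mps_def plus_mps_def case_prod_unfold distrib_right sum.distrib)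
  show "(0::('a, 'b) mps) \<noteq> 1"
  proof
    assume "(0::('a, 'b) mps) = 1"
    then have "mps_coeff (0::('a, 'b) mps) 0 = mps_coeff 1 0" by simp
    then show False by (simp add: zero_mps_def one_mps_def)
  qed
qed (auto intro!: mps_eqI simp: plus_mps_def zero_mps_def uminus_mps_def minus_mps_def algebra_simps)

end

lemma mps_coeff_0 [simp]: "mps_coeff 0 \<alpha> = 0"
  by (simp add: zero_mps_def)

lemma mps_coeff_1: "mps_coeff 1 \<alpha> = (if \<alpha> = 0 then 1 else 0)"
  by (simp add: one_mps_def)

lemma mps_coeff_add [simp]: "mps_coeff (f + g) \<alpha> = mps_coeff f \<alpha> + mps_coeff g \<alpha>"
  by (simp add: plus_mps_def)

lemma mps_coeff_mult:
  "mps_coeff (f * g) \<alpha> = (\<Sum>(\<beta>, \<gamma>)\<in>splits \<alpha>. mps_coeff f \<beta> * mps_coeff g \<gamma>)"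
  by (simp add: times_mps_def)

text \<open>
  The ring of power series in the indeterminates $w_i$ with $i \in I$. Keeping \<open>I\<close> a subset of
  the index type, instead of the whole type, admits the empty index set.
\<close>

definition mps_over :: "'i set \<Rightarrow> ('i, 'r :: zero) mps set" where
  "mps_over I = {f. \<forall>\<alpha>. mps_coeff f \<alpha> \<noteq> 0 \<longrightarrow> Poly_Mapping.keys \<alpha> \<subseteq> I}"

section \<open>The additional indeterminate $z$\<close>

text \<open>
  Power series in $z$ and $w$ are elements of $R[[w]][[z]]$, i.e. of type
  \<^typ>\<open>('i, 'r) mps fps\<close>; \<^const>\<open>fps_deriv\<close> is then the partial derivative with respect to $z$.
\<close>

definition zw_over :: "'i set \<Rightarrow> ('i, 'r :: zero) mps fps set" where
  "zw_over I = {F. \<forall>n. fps_nth F n \<in> mps_over I}"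

definition zw_coeff :: "('i, 'r) mps fps \<Rightarrow> nat \<Rightarrow> ('i \<Rightarrow>\<^sub>0 nat) \<Rightarrow> 'r" where
  "zw_coeff F n \<alpha> = mps_coeff (fps_nth F n) \<alpha>"

text \<open>
  $F(\varphi(w), w) = \sum_n F_n(w) \varphi(w)^n$, summed coefficientwise. Only finitely many terms
  contribute to each coefficient if $\varphi$ has zero constant term, see
  \<open>subst_z_finite\<close> below; the definition is meant for this case only.
\<close>

definition subst_z :: "('i, 'r :: comm_ring_1) mps fps \<Rightarrow> ('i, 'r) mps \<Rightarrow> ('i, 'r) mps" where
  "subst_z F \<phi> = Abs_mps (\<lambda>\<alpha>. Sum_any (\<lambda>n. mps_coeff (fps_nth F n * \<phi> ^ n) \<alpha>))"

lemma mps_coeff_mult_power_eq_0: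
  fixes f \<phi> :: "('i, 'r :: comm_ring_1) mps"
  assumes "mps_coeff \<phi> 0 = 0" and "midx_size \<alpha> < n"
  shows "mps_coeff (f * \<phi> ^ n) \<alpha> = 0"
  using assms(2)
proof (induction n arbitrary: \<alpha>)
  case (Suc n)
  have "mps_coeff (f * \<phi> ^ n) \<beta> * mps_coeff \<phi> \<gamma> = 0" if "\<beta> + \<gamma> = \<alpha>" for \<beta> \<gamma>
  proof (cases "\<gamma> = 0")
    case False
    then have "midx_size \<beta> < n"
      using that Suc.prems midx_size_add[of \<beta> \<gamma>] midx_size_eq_0_iff[of \<gamma>] by auto
    then show ?thesis by (simp add: Suc.IH)
  qed (simp add: assms(1))
  then have "mps_coeff ((f * \<phi> ^ n) * \<phi>) \<alpha> = 0"
    unfolding mps_coeff_mult[of "f * \<phi> ^ n"] by (intro sum.neutral) (auto simp: splits_def)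
  then show ?case by (simp add: mult_ac)
qed simp

lemma subst_z_finite:
  fixes F :: "('i, 'r :: comm_ring_1) mps fps"
  assumes "mps_coeff \<phi> 0 = 0"
  shows "finite {n. mps_coeff (fps_nth F n * \<phi> ^ n) \<alpha> \<noteq> 0}"
    and "mps_coeff (subst_z F \<phi>) \<alpha> = (\<Sum>n\<le>midx_size \<alpha>. mps_coeff (fps_nth F n * \<phi> ^ n) \<alpha>)"
proof -
  have sub: "{n. mps_coeff (fps_nth F n * \<phi> ^ n) \<alpha> \<noteq> 0} \<subseteq> {..midx_size \<alpha>}"
  proof
    fix n assume "n \<in> {n. mps_coeff (fps_nth F n * \<phi> ^ n) \<alpha> \<noteq> 0}"
    then have "\<not> midx_size \<alpha> < n" using mps_coeff_mult_power_eq_0[OF assms] by blast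
    then show "n \<in> {..midx_size \<alpha>}" by simp
  qed
  then show "finite {n. mps_coeff (fps_nth F n * \<phi> ^ n) \<alpha> \<noteq> 0}"
    by (rule finite_subset) simp
  show "mps_coeff (subst_z F \<phi>) \<alpha> = (\<Sum>n\<le>midx_size \<alpha>. mps_coeff (fps_nth F n * \<phi> ^ n) \<alpha>)"
    using Sum_any.expand_superset[OF _ sub] by (simp add: subst_z_def)
qed

section \<open>Rings containing the rationals\<close>

text \<open>
  A unital ring embedding of the rationals; there is at most one, and it serves to write the
  coefficients $1/m$.
\<close>

definition rat_embedding :: "(rat \<Rightarrow> 'r :: comm_ring_1) \<Rightarrow> bool" where
  "rat_embedding \<iota> \<longleftrightarrow> inj \<iota> \<and> \<iota> 1 = 1 \<and>
     (\<forall>x y. \<iota> (x + y) = \<iota> x + \<iota> y) \<and> (\<forall>x y. \<iota> (x * y) = \<iota> x * \<iota> y)"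

end

theory Submission
  imports Defs
begin

text \<open>
  Fix a solution $\varphi$ of $\varphi = G(\varphi, w)$ with zero constant term, and let $L(H)$
  be the right-hand side of the formula for $H$ (\<open>lagrange_sum\<close> below). The map $L$ is additive,
  and so is $H \mapsto H(\varphi, w)$; the two agree for the following reasons.

  Every $H$ is of the form $H(\varphi(w), w) + (z - G) K$ (\<open>fixed_point_ideal\<close>). Indeed
  $H - H(\varphi, w) = (z - \varphi) Q_H$ for an explicit series $Q_H$. Taking $H = G$ gives
  $z - G = (z - \varphi)(1 - Q_G)$, where $Q_G(0, 0) = (\partial G / \partial z)(0, 0) = 0$, so
  $1 - Q_G$ is a unit and $z - \varphi$ is a multiple of $z - G$.

  A series $c(w)$ has derivative zero, so $L(c) = c$. It remains to see that
  $L((z - G) K) = 0$ (\<open>lagrange_sum_X_minus_G\<close>). Expanding $\partial(H G^m) / \partial\zeta$ gives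
  \[ \frac1m [\zeta^{m-1}] \frac{\partial H}{\partial\zeta} G^m
      = [\zeta^m] H G^m - [\zeta^{m-1}] H \frac{\partial G}{\partial\zeta} G^{m-1}, \]
  and hence $L(H) = \sum_{m \ge 0} [\zeta^m] H (1 - \partial G / \partial\zeta) G^m$. For
  $H = (z - G) K$ this sum telescopes to zero.

  All these sums are finite in each coefficient: if $\zeta^n w^\alpha$ is given the weight
  $n + 2 |\alpha|$, then $G$ has no term of weight less than $2$, and $G^m$ none of weight less
  than $2 m$ (\<open>zw_coeff_mult_power_eq_0\<close>). This is also where the bound $2 |\alpha| - 1$ comes from.

  The case $H = z$ shows that every solution has the stated coefficients, which gives uniqueness.
  Existence follows by iterating $\varphi \mapsto G(\varphi, w)$ from $0$: each step makes the
  coefficients of one further total degree final (\<open>subst_z_contraction\<close>).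
\<close>

section \<open>Coefficients of power series\<close>

lemma mps_coeff_diff [simp]: "mps_coeff (f - g) \<alpha> = mps_coeff f \<alpha> - mps_coeff g \<alpha>"
  by (simp add: minus_mps_def)

lemma mps_coeff_sum: "mps_coeff (sum f A) \<alpha> = (\<Sum>x\<in>A. mps_coeff (f x) \<alpha>)"
  by (induction A rule: infinite_finite_induct) auto

lemma mps_coeff_of_nat_mult: "mps_coeff (of_nat n * f) \<alpha> = of_nat n * mps_coeff f \<alpha>"
  by (induction n) (auto simp: distrib_right)

lemma mps_coeff_mult_zero_index: "mps_coeff (f * g) 0 = mps_coeff f 0 * mps_coeff g 0"
  by (simp add: mps_coeff_mult)

lemma mps_coeff_power_zero_index: "mps_coeff (f ^ n) 0 = mps_coeff f 0 ^ n"
  by (induction n) (auto simp: mps_coeff_1 mps_coeff_mult_zero_index)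

lemma mps_coeff_mult_eq_0_if_low_order:
  assumes "\<And>\<beta>. midx_size \<beta> < k \<Longrightarrow> mps_coeff f \<beta> = 0"
    and "mps_coeff g 0 = 0" and "midx_size \<alpha> \<le> k"
  shows "mps_coeff (f * g) \<alpha> = 0"
  unfolding mps_coeff_mult
proof (intro sum.neutral ballI, clarify)
  fix \<beta> \<gamma> assume "(\<beta>, \<gamma>) \<in> splits \<alpha>"
  then have sz: "midx_size \<beta> + midx_size \<gamma> \<le> k"
    using assms(3) midx_size_add[of \<beta> \<gamma>] by (simp add: splits_def)
  show "mps_coeff f \<beta> * mps_coeff g \<gamma> = 0"
  proof (cases "\<gamma> = 0")
    case False
    then have "midx_size \<beta> < k" using sz midx_size_eq_0_iff[of \<gamma>] by auto
    then show ?thesis by (simp add: assms(1))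
  qed (simp add: assms(2))
qed

lemma zw_coeff_add: "zw_coeff (F + F') n \<alpha> = zw_coeff F n \<alpha> + zw_coeff F' n \<alpha>"
  and zw_coeff_diff: "zw_coeff (F - F') n \<alpha> = zw_coeff F n \<alpha> - zw_coeff F' n \<alpha>"
  and zw_coeff_0: "zw_coeff 0 n \<alpha> = 0"
  by (simp_all add: zw_coeff_def)

lemma zw_coeff_mult:
  "zw_coeff (F * F') n \<alpha> =
     (\<Sum>i=0..n. \<Sum>(\<beta>, \<gamma>)\<in>splits \<alpha>. zw_coeff F i \<beta> * zw_coeff F' (n - i) \<gamma>)"
  by (simp add: zw_coeff_def fps_mult_nth mps_coeff_sum mps_coeff_mult)

lemma zw_coeff_deriv: "zw_coeff (fps_deriv F) n \<alpha> = of_nat (Suc n) * zw_coeff F (Suc n) \<alpha>"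
  using mps_coeff_of_nat_mult[of "Suc n" "fps_nth F (Suc n)" \<alpha>] by (simp add: zw_coeff_def)

section \<open>Series over a set of indeterminates\<close>

lemma mps_over_mult:
  assumes "f \<in> mps_over I" "g \<in> mps_over I"
  shows "f * g \<in> mps_over I"
  unfolding mps_over_def
proof (intro CollectI allI impI)
  fix \<alpha> assume "mps_coeff (f * g) \<alpha> \<noteq> 0"
  then obtain \<beta> \<gamma> where "(\<beta>, \<gamma>) \<in> splits \<alpha>" "mps_coeff f \<beta> * mps_coeff g \<gamma> \<noteq> 0"
    unfolding mps_coeff_mult by (auto elim!: sum.not_neutral_contains_not_neutral)
  then have "\<alpha> = \<beta> + \<gamma>" "mps_coeff f \<beta> \<noteq> 0" "mps_coeff g \<gamma> \<noteq> 0"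
    by (auto simp: splits_def)
  then show "Poly_Mapping.keys \<alpha> \<subseteq> I"
    using assms Poly_Mapping.keys_add[of \<beta> \<gamma>] unfolding mps_over_def by blast
qed

lemma mps_over_0: "0 \<in> mps_over I"
  and mps_over_1: "1 \<in> mps_over I"
  by (simp_all add: mps_over_def mps_coeff_1)

lemma mps_over_power: "f \<in> mps_over I \<Longrightarrow> f ^ n \<in> mps_over I"
  by (induction n) (auto intro: mps_over_mult mps_over_1)

lemma mps_over_subst_z:
  assumes "F \<in> zw_over I" "\<phi> \<in> mps_over I" "mps_coeff \<phi> 0 = 0"
  shows "subst_z F \<phi> \<in> mps_over I"
  unfolding mps_over_def
proof (intro CollectI allI impI)
  fix \<alpha> assume "mps_coeff (subst_z F \<phi>) \<alpha> \<noteq> 0"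
  then obtain n where "mps_coeff (fps_nth F n * \<phi> ^ n) \<alpha> \<noteq> 0"
    unfolding subst_z_finite(2)[OF assms(3)] by (auto elim!: sum.not_neutral_contains_not_neutral)
  moreover have "fps_nth F n * \<phi> ^ n \<in> mps_over I"
    using assms by (auto simp: zw_over_def intro: mps_over_mult mps_over_power)
  ultimately show "Poly_Mapping.keys \<alpha> \<subseteq> I" by (auto simp: mps_over_def)
qed

section \<open>Substitution for $z$ and division by $z - \varphi$\<close>

text \<open>
  Lets an infinite substitution be replaced by one finite sum whose range does not depend on the
  splitting of \<open>\<alpha>\<close> in a product.
\<close>

lemma mps_coeff_mult_subst_z:
  assumes "mps_coeff \<phi> 0 = 0" and "midx_size \<alpha> \<le> N"
  shows "mps_coeff (f * subst_z F \<phi>) \<alpha> = (\<Sum>n\<le>N. mps_coeff (f * (fps_nth F n * \<phi> ^ n)) \<alpha>)"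
proof -
  have expand: "mps_coeff (subst_z F \<phi>) \<gamma> = mps_coeff (\<Sum>n\<le>N. fps_nth F n * \<phi> ^ n) \<gamma>"
    if "midx_size \<gamma> \<le> N" for \<gamma>
    unfolding subst_z_finite(2)[OF assms(1)] mps_coeff_sum
    by (rule sum.mono_neutral_left)
       (use that assms(1) in \<open>auto intro!: mps_coeff_mult_power_eq_0\<close>)
  have "mps_coeff (f * subst_z F \<phi>) \<alpha> = mps_coeff (f * (\<Sum>n\<le>N. fps_nth F n * \<phi> ^ n)) \<alpha>"
    unfolding mps_coeff_mult
  proof (rule sum.cong[OF refl], clarify)
    fix \<beta> \<gamma> assume "(\<beta>, \<gamma>) \<in> splits \<alpha>"
    then have "midx_size \<gamma> \<le> N"
      using assms(2) midx_size_add[of \<beta> \<gamma>] by (simp add: splits_def)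
    then show "mps_coeff f \<beta> * mps_coeff (subst_z F \<phi>) \<gamma> =
        mps_coeff f \<beta> * mps_coeff (\<Sum>n\<le>N. fps_nth F n * \<phi> ^ n) \<gamma>"
      by (simp add: expand)
  qed
  then show ?thesis by (simp add: sum_distrib_left mps_coeff_sum)
qed

lemma subst_z_unfold:
  assumes "mps_coeff \<phi> 0 = 0"
  shows "subst_z F \<phi> = fps_nth F 0 + \<phi> * subst_z (fps_shift 1 F) \<phi>"
proof (rule mps_eqI)
  fix \<alpha>
  have "mps_coeff (subst_z F \<phi>) \<alpha> = (\<Sum>n\<le>Suc (midx_size \<alpha>). mps_coeff (fps_nth F n * \<phi> ^ n) \<alpha>)"
    using mps_coeff_mult_subst_z[OF assms, of \<alpha> "Suc (midx_size \<alpha>)" 1 F] by simp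
  also have "\<dots> = mps_coeff (fps_nth F 0) \<alpha> +
      (\<Sum>n\<le>midx_size \<alpha>. mps_coeff (\<phi> * (fps_nth (fps_shift 1 F) n * \<phi> ^ n)) \<alpha>)"
    by (subst sum.atMost_Suc_shift) (simp add: mult_ac)
  also have "\<dots> = mps_coeff (fps_nth F 0 + \<phi> * subst_z (fps_shift 1 F) \<phi>) \<alpha>"
    by (simp add: mps_coeff_mult_subst_z[OF assms order_refl])
  finally show "mps_coeff (subst_z F \<phi>) \<alpha> =
      mps_coeff (fps_nth F 0 + \<phi> * subst_z (fps_shift 1 F) \<phi>) \<alpha>" .
qed

lemma mps_coeff_subst_z_zero_index:
  assumes "mps_coeff \<phi> 0 = 0"
  shows "mps_coeff (subst_z F \<phi>) 0 = zw_coeff F 0 0"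
  using subst_z_finite(2)[OF assms, of F 0] by (simp add: zw_coeff_def)

lemma subst_z_0: "subst_z F 0 = fps_nth F 0"
  using subst_z_unfold[of 0 F] by simp

lemma subst_z_X:
  fixes \<phi> :: "('i, 'r :: comm_ring_1) mps"
  assumes "mps_coeff \<phi> 0 = 0"
  shows "subst_z fps_X \<phi> = \<phi>"
proof -
  have "fps_shift 1 fps_X = (1 :: ('i, 'r) mps fps)" and "fps_shift 1 1 = (0 :: ('i, 'r) mps fps)"
    by (rule fps_ext, simp)+
  moreover have "subst_z 0 \<phi> = 0"
    by (rule mps_eqI) (simp add: subst_z_finite(2)[OF assms])
  ultimately have "subst_z (fps_shift 1 fps_X) \<phi> = 1"
    using subst_z_unfold[OF assms, of 1] by simp
  then show ?thesis using subst_z_unfold[OF assms, of fps_X] by simp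
qed

text \<open>
  Division of \<open>F\<close> by $z - \varphi$ with remainder, as in Horner's scheme: the coefficients
  $Q_n = \sum_{k > n} F_k \varphi^{k-n-1}$ of the quotient satisfy
  $Q_{n-1} = F_n + \varphi Q_n$ by \<open>subst_z_unfold\<close>.
\<close>

lemma fps_divide_X_minus_const:
  assumes "mps_coeff \<phi> 0 = 0"
  shows "F = fps_const (subst_z F \<phi>) +
    (fps_X - fps_const \<phi>) * Abs_fps (\<lambda>n. subst_z (fps_shift (Suc n) F) \<phi>)"
proof (rule fps_ext)
  fix n
  have "subst_z (fps_shift n F) \<phi> = fps_nth F n + \<phi> * subst_z (fps_shift (Suc n) F) \<phi>" for n
  proof -
    have "fps_shift 1 (fps_shift n F) = fps_shift (Suc n) F" by (rule fps_ext) simp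
    then show ?thesis using subst_z_unfold[OF assms, of "fps_shift n F"] by simp
  qed
  from this[of n] this[of 0]
  show "fps_nth F n = fps_nth (fps_const (subst_z F \<phi>) +
      (fps_X - fps_const \<phi>) * Abs_fps (\<lambda>n. subst_z (fps_shift (Suc n) F) \<phi>)) n"
    by (cases n) (simp_all add: left_diff_distrib)
qed

text \<open>The inverse is the geometric series in $1 - f$.\<close>

lemma mps_unit_if_constant_1:
  fixes f :: "('i, 'r :: comm_ring_1) mps"
  assumes "mps_coeff f 0 = 1"
  obtains g where "f * g = 1"
proof
  have zero: "mps_coeff (1 - f) 0 = 0" using assms by (simp add: mps_coeff_1)
  have shift: "fps_shift 1 (Abs_fps (\<lambda>_. 1)) = Abs_fps (\<lambda>_. 1 :: ('i, 'r) mps)"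
    by (rule fps_ext) simp
  show "f * subst_z (Abs_fps (\<lambda>_. 1)) (1 - f) = 1"
    using subst_z_unfold[OF zero, of "Abs_fps (\<lambda>_. 1)"] unfolding shift by (simp add: algebra_simps)
qed

text \<open>
  Modulo $z - G$, every series is congruent to its value at the fixed point, because $z - G$ and
  $z - \varphi$ differ by a unit.
\<close>

lemma fixed_point_ideal:
  assumes "zw_coeff (fps_deriv G) 0 0 = 0" and "mps_coeff \<phi> 0 = 0" and "\<phi> = subst_z G \<phi>"
  obtains K where "H = fps_const (subst_z H \<phi>) + (fps_X - G) * K"
proof -
  define Q where "Q F = Abs_fps (\<lambda>n. subst_z (fps_shift (Suc n) F) \<phi>)" for F
  have Q: "F = fps_const (subst_z F \<phi>) + (fps_X - fps_const \<phi>) * Q F" for F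
    unfolding Q_def by (rule fps_divide_X_minus_const[OF assms(2)])
  have "mps_coeff (fps_nth (Q G) 0) 0 = 0"
    using assms(1) by (simp add: Q_def mps_coeff_subst_z_zero_index[OF assms(2)] zw_coeff_def)
  then have "mps_coeff (fps_nth (1 - Q G) 0) 0 = 1" by (simp add: mps_coeff_1)
  then obtain g where "fps_nth (1 - Q G) 0 * g = 1" by (rule mps_unit_if_constant_1)
  then have unit: "(1 - Q G) * fps_right_inverse (1 - Q G) g = 1" (is "_ * ?V = 1")
    by (rule fps_right_inverse)
  have "fps_X - G = (fps_X - fps_const \<phi>) * (1 - Q G)"
    using Q[of G] assms(3) by (simp add: algebra_simps)
  then have "(fps_X - G) * (?V * Q H) = (fps_X - fps_const \<phi>) * ((1 - Q G) * ?V) * Q H"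
    by (simp only: mult.assoc)
  then have "(fps_X - G) * (?V * Q H) = (fps_X - fps_const \<phi>) * Q H"
    by (simp add: unit)
  with Q[of H] show ?thesis by (intro that[of "?V * Q H"]) simp
qed

section \<open>Existence of the fixed point\<close>

text \<open>
  In $G(\varphi, w) - G(\psi, w)$ the term $G_n (\varphi^n - \psi^n)$ is $\varphi - \psi$ times a
  series with zero constant term: for $n = 1$ because of the hypothesis on the derivative, for
  $n \ge 2$ because $\varphi$ and $\psi$ have zero constant term. So agreement of $\varphi$ and
  $\psi$ in total degrees below \<open>k\<close> improves to agreement up to \<open>k\<close>.
\<close>

lemma subst_z_contraction:
  fixes G :: "('i, 'r :: comm_ring_1) mps fps"
  assumes "zw_coeff (fps_deriv G) 0 0 = 0"
    and "mps_coeff \<phi> 0 = 0" "mps_coeff \<psi> 0 = 0"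
    and "\<And>\<beta>. midx_size \<beta> < k \<Longrightarrow> mps_coeff \<phi> \<beta> = mps_coeff \<psi> \<beta>"
    and "midx_size \<alpha> \<le> k"
  shows "mps_coeff (subst_z G \<phi>) \<alpha> = mps_coeff (subst_z G \<psi>) \<alpha>"
proof -
  have "mps_coeff (fps_nth G n * \<phi> ^ n) \<alpha> - mps_coeff (fps_nth G n * \<psi> ^ n) \<alpha> = 0" for n
  proof -
    define D where "D = fps_nth G n * (\<Sum>i<n. \<psi> ^ (n - Suc i) * \<phi> ^ i)"
    have "mps_coeff D 0 = 0"
    proof (cases "n = 1")
      case True
      then show ?thesis using assms(1) by (simp add: D_def zw_coeff_def)
    next
      case False
      then have "n - Suc i > 0 \<or> i > 0" if "i < n" for i using that by auto
      then have "(0 :: 'r) ^ (n - Suc i) * 0 ^ i = 0" if "i < n" for i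
        using that by (metis mult_zero_left mult_zero_right zero_power)
      then have "(\<Sum>i<n. (0 :: 'r) ^ (n - Suc i) * 0 ^ i) = 0" by (intro sum.neutral) simp
      then show ?thesis
        by (simp add: D_def mps_coeff_mult_zero_index mps_coeff_sum mps_coeff_power_zero_index
            assms(2,3))
    qed
    then have "mps_coeff ((\<phi> - \<psi>) * D) \<alpha> = 0"
      using assms(4,5) by (intro mps_coeff_mult_eq_0_if_low_order) auto
    moreover have "(\<phi> - \<psi>) * D = fps_nth G n * (\<phi> ^ n - \<psi> ^ n)"
      unfolding D_def power_diff_sumr2 by (simp only: mult_ac)
    ultimately show ?thesis by (simp add: right_diff_distrib)
  qed
  then show ?thesis by (simp add: subst_z_finite(2) assms(2,3))
qed

lemma fixed_point_exists:
  assumes "G \<in> zw_over I" "zw_coeff G 0 0 = 0" "zw_coeff (fps_deriv G) 0 0 = 0"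
  obtains \<phi> where "\<phi> \<in> mps_over I" "mps_coeff \<phi> 0 = 0" "\<phi> = subst_z G \<phi>"
proof -
  define it where "it n = (subst_z G ^^ n) 0" for n
  have it_Suc: "it (Suc n) = subst_z G (it n)" for n by (simp add: it_def)
  have it0: "mps_coeff (it n) 0 = 0" for n
    by (induction n) (simp_all add: it_Suc mps_coeff_subst_z_zero_index assms(2), simp add: it_def)
  have it_over: "it n \<in> mps_over I" for n
  proof (induction n)
    case 0 show ?case by (simp add: it_def mps_over_0)
  next
    case (Suc n) then show ?case unfolding it_Suc by (intro mps_over_subst_z assms it0)
  qed
  have step: "mps_coeff (it (Suc n)) \<alpha> = mps_coeff (it n) \<alpha>" if "midx_size \<alpha> \<le> n" for n \<alpha>
    using that
  proof (induction n arbitrary: \<alpha>)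
    case 0
    then show ?case using it0 by (simp add: midx_size_eq_0_iff)
  next
    case (Suc n)
    then show ?case
      unfolding it_Suc[of "Suc n"] it_Suc[of n]
      by (intro subst_z_contraction[where k = "Suc n"] assms it0) (auto simp: it_Suc it0)
  qed
  have stable: "mps_coeff (it n) \<alpha> = mps_coeff (it (midx_size \<alpha>)) \<alpha>" if "midx_size \<alpha> \<le> n" for n \<alpha>
    using that by (induction n rule: dec_induct) (simp_all add: step)
  \<comment> \<open>The limit: a coefficient of size $k$ no longer changes from the $k$-th iterate on.\<close>
  define \<phi> where "\<phi> = Abs_mps (\<lambda>\<alpha>. mps_coeff (it (midx_size \<alpha>)) \<alpha>)"
  have \<phi>0: "mps_coeff \<phi> 0 = 0" by (simp add: \<phi>_def it0)
  show ?thesis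
  proof
    show "mps_coeff \<phi> 0 = 0" by fact
    show "\<phi> \<in> mps_over I" using it_over by (auto simp: \<phi>_def mps_over_def)
    show "\<phi> = subst_z G \<phi>"
    proof (rule mps_eqI)
      fix \<alpha>
      have "mps_coeff (subst_z G \<phi>) \<alpha> = mps_coeff (it (Suc (midx_size \<alpha>))) \<alpha>"
        unfolding it_Suc
        by (intro subst_z_contraction[where k = "midx_size \<alpha>"] assms \<phi>0 it0)
           (auto simp: \<phi>_def intro!: stable[symmetric])
      then show "mps_coeff \<phi> \<alpha> = mps_coeff (subst_z G \<phi>) \<alpha>"
        by (simp add: step) (simp add: \<phi>_def)
    qed
  qed
qed

section \<open>The Lagrange sum\<close>

text \<open>
  With $\zeta^n w^\alpha$ of weight $n + 2 |\alpha|$, the monomials of weight below $2$ are $1$ and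
  $\zeta$; both are absent from $G$, so multiplication by $G$ raises the lowest weight by $2$.
\<close>

lemma zw_coeff_mult_power_eq_0:
  assumes "zw_coeff G 0 0 = 0" "zw_coeff (fps_deriv G) 0 0 = 0"
    and "n + 2 * midx_size \<alpha> < 2 * m"
  shows "zw_coeff (F * G ^ m) n \<alpha> = 0"
  using assms(3)
proof (induction m arbitrary: n \<alpha>)
  case (Suc m)
  have G: "zw_coeff G i 0 = 0" if "i < 2" for i
    using that assms(1,2) zw_coeff_deriv[of G 0 0] by (cases i) auto
  have "zw_coeff (F * G ^ m) i \<beta> * zw_coeff G (n - i) \<gamma> = 0"
    if "i \<le> n" "\<beta> + \<gamma> = \<alpha>" for i \<beta> \<gamma>
  proof (cases "i + 2 * midx_size \<beta> < 2 * m")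
    case False
    then have "n - i + 2 * midx_size \<gamma> < 2"
      using Suc.prems that midx_size_add[of \<beta> \<gamma>] by auto
    then have "\<gamma> = 0" "n - i < 2" using midx_size_eq_0_iff[of \<gamma>] by auto
    then show ?thesis by (simp add: G)
  qed (simp add: Suc.IH)
  then have "zw_coeff ((F * G ^ m) * G) n \<alpha> = 0"
    unfolding zw_coeff_mult[of "F * G ^ m"] by (intro sum.neutral ballI) (auto simp: splits_def)
  then show ?case by (simp add: mult_ac)
qed simp

definition lagrange_sum ::
    "(rat \<Rightarrow> 'r) \<Rightarrow> ('i, 'r) mps fps \<Rightarrow> ('i, 'r) mps fps \<Rightarrow> ('i \<Rightarrow>\<^sub>0 nat) \<Rightarrow> 'r :: comm_ring_1" where
  "lagrange_sum \<iota> G H \<alpha> = zw_coeff H 0 \<alpha> +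
     (\<Sum>m = 1..2 * midx_size \<alpha> - 1. \<iota> (1 / of_nat m) * zw_coeff (fps_deriv H * G ^ m) (m - 1) \<alpha>)"

lemma lagrange_sum_add:
  "lagrange_sum \<iota> G (H + H') \<alpha> = lagrange_sum \<iota> G H \<alpha> + lagrange_sum \<iota> G H' \<alpha>"
  by (simp add: lagrange_sum_def zw_coeff_add distrib_left distrib_right sum.distrib)

lemma lagrange_sum_const: "lagrange_sum \<iota> G (fps_const c) \<alpha> = mps_coeff c \<alpha>"
  by (simp add: lagrange_sum_def zw_coeff_0) (simp add: zw_coeff_def)

lemma rat_embedding_of_nat:
  assumes "rat_embedding \<iota>"
  shows "\<iota> (of_nat n) = of_nat n"
proof (induction n)
  case 0
  have "\<iota> (0 + 0) = \<iota> 0 + \<iota> 0" using assms unfolding rat_embedding_def by blast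
  then show ?case by simp
next
  case (Suc n) then show ?case using assms unfolding rat_embedding_def by simp
qed

text \<open>
  The product rule for $H G^{m+1}$, read off at $\zeta^m$, carries a common factor $m + 1$ that
  \<open>\<iota>\<close> allows to cancel. This is the only use of division.
\<close>

lemma lagrange_term:
  assumes "rat_embedding \<iota>"
  shows "\<iota> (1 / of_nat (Suc m)) * zw_coeff (fps_deriv H * G ^ Suc m) m \<alpha> =
    zw_coeff (H * G ^ Suc m) (Suc m) \<alpha> - zw_coeff (H * fps_deriv G * G ^ m) m \<alpha>"
proof -
  have inv: "\<iota> (1 / of_nat (Suc m)) * of_nat (Suc m) = 1"
  proof -
    have "\<iota> (1 / of_nat (Suc m)) * \<iota> (of_nat (Suc m)) = \<iota> (1 / of_nat (Suc m) * of_nat (Suc m))"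
      using assms unfolding rat_embedding_def by metis
    also have "\<dots> = 1" using assms by (simp add: rat_embedding_def del: of_nat_Suc)
    finally show ?thesis unfolding rat_embedding_of_nat[OF assms] .
  qed
  have deriv: "fps_deriv (H * G ^ Suc m) =
      fps_deriv H * G ^ Suc m + of_nat (Suc m) * (H * fps_deriv G * G ^ m)"
    by (simp only: fps_deriv_mult fps_deriv_power fps_of_nat diff_Suc_1 mult_ac add_ac)
  have scale: "zw_coeff (of_nat (Suc m) * F) m \<alpha> = of_nat (Suc m) * zw_coeff F m \<alpha>" for F
    by (simp only: zw_coeff_def fps_of_nat[symmetric] fps_mult_left_const_nth mps_coeff_of_nat_mult)
  have "of_nat (Suc m) * zw_coeff (H * G ^ Suc m) (Suc m) \<alpha> =
      zw_coeff (fps_deriv H * G ^ Suc m) m \<alpha> +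
      of_nat (Suc m) * zw_coeff (H * fps_deriv G * G ^ m) m \<alpha>"
    unfolding zw_coeff_deriv[symmetric] deriv zw_coeff_add scale ..
  then have "\<iota> (1 / of_nat (Suc m)) * zw_coeff (fps_deriv H * G ^ Suc m) m \<alpha> =
      (\<iota> (1 / of_nat (Suc m)) * of_nat (Suc m)) *
      (zw_coeff (H * G ^ Suc m) (Suc m) \<alpha> - zw_coeff (H * fps_deriv G * G ^ m) m \<alpha>)"
    by (simp only: mult.assoc right_diff_distrib) (simp add: algebra_simps)
  then show ?thesis by (simp only: inv mult_1)
qed

text \<open>
  Summing \<open>lagrange_term\<close> and collecting equal exponents of \<open>G\<close>. The range is extended to any
  \<open>N\<close> past the support, where the unmatched last term vanishes as well.
\<close>

lemma lagrange_sum_division_free: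
  assumes "rat_embedding \<iota>" "zw_coeff G 0 0 = 0" "zw_coeff (fps_deriv G) 0 0 = 0"
    and N: "2 * midx_size \<alpha> < N"
  shows "lagrange_sum \<iota> G H \<alpha> = (\<Sum>m\<le>N. zw_coeff (H * (1 - fps_deriv G) * G ^ m) m \<alpha>)"
proof -
  let ?t = "\<lambda>m. \<iota> (1 / of_nat m) * zw_coeff (fps_deriv H * G ^ m) (m - 1) \<alpha>"
  let ?A = "\<lambda>m. zw_coeff (H * G ^ m) m \<alpha>" and ?B = "\<lambda>m. zw_coeff (H * fps_deriv G * G ^ m) m \<alpha>"
  have "(\<Sum>m = 1..2 * midx_size \<alpha> - 1. ?t m) = (\<Sum>m = 1..N. ?t m)"
  proof (rule sum.mono_neutral_left)
    show "{1..2 * midx_size \<alpha> - 1} \<subseteq> {1..N}" using N by force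
    show "\<forall>m\<in>{1..N} - {1..2 * midx_size \<alpha> - 1}. ?t m = 0"
    proof
      fix m assume "m \<in> {1..N} - {1..2 * midx_size \<alpha> - 1}"
      then have "m - 1 + 2 * midx_size \<alpha> < 2 * m" by auto
      then show "?t m = 0" by (simp only: zw_coeff_mult_power_eq_0[OF assms(2,3)] mult_zero_right)
    qed
  qed simp
  also have "\<dots> = (\<Sum>m<N. ?t (Suc m))"
    using sum.atLeast1_atMost_eq[of ?t N] by simp
  also have "\<dots> = (\<Sum>m<N. ?A (Suc m) - ?B m)"
    by (intro sum.cong refl) (simp only: diff_Suc_1 lagrange_term[OF assms(1)])
  finally have "lagrange_sum \<iota> G H \<alpha> = ?A 0 + (\<Sum>m<N. ?A (Suc m) - ?B m)"
    by (simp add: lagrange_sum_def)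
  also have "\<dots> = (\<Sum>m\<le>N. ?A m) - (\<Sum>m<N. ?B m)"
    by (simp add: sum.atMost_shift sum_subtractf)
  also have "(\<Sum>m<N. ?B m) = (\<Sum>m\<le>N. ?B m)"
    using N by (simp add: lessThan_Suc_atMost[symmetric] zw_coeff_mult_power_eq_0[OF assms(2,3)])
  also have "(\<Sum>m\<le>N. ?A m) - (\<Sum>m\<le>N. ?B m) =
      (\<Sum>m\<le>N. zw_coeff (H * (1 - fps_deriv G) * G ^ m) m \<alpha>)"
    unfolding sum_subtractf[symmetric]
    by (intro sum.cong refl) (simp add: zw_coeff_diff[symmetric] algebra_simps)
  finally show ?thesis .
qed

text \<open>
  With $P = K (1 - \partial G / \partial\zeta)$, the $m$-th term is
  $[\zeta^{m-1}] P G^m - [\zeta^m] P G^{m+1}$, and the sum telescopes.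
\<close>

lemma lagrange_sum_X_minus_G:
  fixes G :: "('i, 'r :: comm_ring_1) mps fps"
  assumes "rat_embedding \<iota>" "zw_coeff G 0 0 = 0" "zw_coeff (fps_deriv G) 0 0 = 0"
  shows "lagrange_sum \<iota> G ((fps_X - G) * K) \<alpha> = 0"
proof -
  define P where "P = K * (1 - fps_deriv G)"
  \<comment> \<open>The case split gives $a_0 = [\zeta^{-1}] P = 0$ its meaning in spite of truncated subtraction.\<close>
  define a where "a m = (if m = 0 then 0 else zw_coeff (P * G ^ m) (m - 1) \<alpha>)" for m
  define N where "N = Suc (2 * midx_size \<alpha>)"
  have "zw_coeff ((fps_X - G) * K * (1 - fps_deriv G) * G ^ m) m \<alpha> = a m - a (Suc m)" for m
  proof -
    have "(fps_X - G) * K * (1 - fps_deriv G) * G ^ m = fps_X * (P * G ^ m) - P * G ^ Suc m"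
      by (simp add: P_def algebra_simps)
    moreover have "zw_coeff (fps_X * F) m \<alpha> = (if m = 0 then 0 else zw_coeff F (m - 1) \<alpha>)"
      for F :: "('i, 'r) mps fps"
      by (simp add: zw_coeff_def)
    ultimately show ?thesis by (simp only: zw_coeff_diff a_def) simp
  qed
  moreover have "2 * midx_size \<alpha> < N" by (simp add: N_def)
  ultimately have "lagrange_sum \<iota> G ((fps_X - G) * K) \<alpha> = (\<Sum>m\<le>N. a m - a (Suc m))"
    by (simp only: lagrange_sum_division_free[OF assms])
  also have "\<dots> = a 0 - a (Suc N)" by (rule sum_telescope)
  also have "\<dots> = 0" by (simp add: a_def N_def zw_coeff_mult_power_eq_0[OF assms(2,3)] del: power_Suc)
  finally show ?thesis .
qed

lemma lagrange_inversion:
  assumes "rat_embedding \<iota>" "zw_coeff G 0 0 = 0" "zw_coeff (fps_deriv G) 0 0 = 0"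
    and "mps_coeff \<phi> 0 = 0" "\<phi> = subst_z G \<phi>"
  shows "mps_coeff (subst_z H \<phi>) \<alpha> = lagrange_sum \<iota> G H \<alpha>"
proof -
  obtain K where "H = fps_const (subst_z H \<phi>) + (fps_X - G) * K"
    using fixed_point_ideal[OF assms(3-5)] .
  then have "lagrange_sum \<iota> G H \<alpha> =
      lagrange_sum \<iota> G (fps_const (subst_z H \<phi>)) \<alpha> + lagrange_sum \<iota> G ((fps_X - G) * K) \<alpha>"
    by (simp only: lagrange_sum_add[symmetric])
  then show ?thesis by (simp add: lagrange_sum_const lagrange_sum_X_minus_G[OF assms(1-3)])
qed

theorem theorem3p6:
  fixes I :: "'i set"
    and \<iota> :: "rat \<Rightarrow> 'r :: comm_ring_1"
    and G :: "('i, 'r) mps fps"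
  assumes "rat_embedding \<iota>"
    and "G \<in> zw_over I"
    and "zw_coeff G 0 0 = 0"
    and "zw_coeff (fps_deriv G) 0 0 = 0"
  shows "\<exists>\<phi>. (\<phi> \<in> mps_over I \<and> mps_coeff \<phi> 0 = 0 \<and> \<phi> = subst_z G \<phi>) \<and>
    (\<forall>\<psi>. \<psi> \<in> mps_over I \<and> mps_coeff \<psi> 0 = 0 \<and> \<psi> = subst_z G \<psi> \<longrightarrow> \<psi> = \<phi>) \<and>
    (\<forall>\<alpha>. Poly_Mapping.keys \<alpha> \<subseteq> I \<longrightarrow>
      mps_coeff \<phi> \<alpha> =
        (\<Sum>m = 1..2 * midx_size \<alpha> - 1. \<iota> (1 / of_nat m) * zw_coeff (G ^ m) (m - 1) \<alpha>)) \<and>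
    (\<forall>H \<in> zw_over I. \<forall>\<alpha>. Poly_Mapping.keys \<alpha> \<subseteq> I \<longrightarrow>
      mps_coeff (subst_z H \<phi>) \<alpha> =
        mps_coeff (subst_z H 0) \<alpha> +
        (\<Sum>m = 1..2 * midx_size \<alpha> - 1.
          \<iota> (1 / of_nat m) * zw_coeff (fps_deriv H * G ^ m) (m - 1) \<alpha>))"
proof -
  obtain \<phi> where \<phi>: "\<phi> \<in> mps_over I" "mps_coeff \<phi> 0 = 0" "\<phi> = subst_z G \<phi>"
    using fixed_point_exists[OF assms(2-4)] .
  note lagrange = lagrange_inversion[OF assms(1,3,4)]
  have coeff: "mps_coeff \<psi> \<alpha> = lagrange_sum \<iota> G fps_X \<alpha>"
    if "mps_coeff \<psi> 0 = 0" "\<psi> = subst_z G \<psi>" for \<psi> \<alpha>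
    using lagrange[OF that, of fps_X] by (simp add: subst_z_X[OF that(1)])
  have "\<psi> = \<phi>" if "mps_coeff \<psi> 0 = 0" "\<psi> = subst_z G \<psi>" for \<psi>
    using coeff[OF that] coeff[OF \<phi>(2,3)] by (intro mps_eqI) simp
  moreover have "mps_coeff \<phi> \<alpha> =
      (\<Sum>m = 1..2 * midx_size \<alpha> - 1. \<iota> (1 / of_nat m) * zw_coeff (G ^ m) (m - 1) \<alpha>)" for \<alpha>
    using coeff[OF \<phi>(2,3), of \<alpha>] by (simp add: lagrange_sum_def) (simp add: zw_coeff_def)
  moreover have "mps_coeff (subst_z H \<phi>) \<alpha> = mps_coeff (subst_z H 0) \<alpha> +
      (\<Sum>m = 1..2 * midx_size \<alpha> - 1.
        \<iota> (1 / of_nat m) * zw_coeff (fps_deriv H * G ^ m) (m - 1) \<alpha>)" for H \<alpha>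
    using lagrange[OF \<phi>(2,3), of H \<alpha>] by (simp add: lagrange_sum_def subst_z_0 zw_coeff_def)
  ultimately show ?thesis using \<phi> by blast
qed

end
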